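(* Let $\Omega\subset\mathbb{R}^n$, $n\ge 2$, be a domain of Lipschitz class with constants $r_0,M$ and diameter bounded by $d_0$, with accessible and inaccessible boundary portions $\Gamma_A,\Gamma_I$, and let $\Gamma_I$ be of class $C^{1,1}$ with constants $r_0,M$. Let $g$ satisfy $\mathrm{supp}\, g\subset\Gamma_A^{\hat r}$ and $\|g\|_{C^{0,\alpha}(\Gamma_A)}\le E$, and let $\gamma\ge0$ satisfy $\mathrm{supp}\,\gamma\subset\Gamma_I$ and $\|\gamma\|_{C^{0,1}(\Gamma_I)}\le\gamma_0$. Let $u\in H^1(\Omega)$ be a weak solution to $$\Delta u=0 \ \text{in } \Omega,\qquad \frac{\partial u}{\partial\nu}=g\ \text{on }\Gamma_A,\qquad \frac{\partial u}{\partial\nu}+\gamma u=0\ \text{on }\Gamma_I .$$ Let $r_2=\min\{\bar r,r_1\}$, where $\bar r$ and $r_1$ are the radii, depending only on the a priori data, described in the context. Then there exists a constant $K>0$ depending only on the a priori data such that for every $r$ with $0<r<r_2$ and every $x_0\in\Gamma_I^{r_0}$, $$\int_{\Delta_r(x_0)}u^2\ \ge\ \frac1K\, r^{K}.$$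
   Context: $\Gamma_A$ and $\Gamma_I$ are two open, disjoint portions of $\partial\Omega$ with $\partial\Omega=\overline{\Gamma_A}\cup\overline{\Gamma_I}$; $\nu$ is the outer unit normal. For $\rho>0$, $\Gamma_A^\rho=\{x\in\Gamma_A:\mathrm{dist}(x,\Gamma_I)>\rho\}$, $\Gamma_I^\rho=\{x\in\Gamma_I:\mathrm{dist}(x,\Gamma_A)>\rho\}$, and for $x_0\in\partial\Omega$, $\Delta_\rho(x_0)=B_\rho(x_0)\cap\partial\Omega$. A domain $\Omega$ is of Lipschitz class with constants $r_0,M>0$ if for any $P\in\partial\Omega$ there is a rigid transformation of coordinates under which $P=0$ and $\Omega\cap B_{r_0}=\{(x',x_n):x_n>\varphi(x')\}$, where $\varphi:B'_{r_0}\subset\mathbb{R}^{n-1}\to\mathbb{R}$ is Lipschitz with $|\varphi(0)|=|\nabla\varphi(0)|=0$ and $\|\varphi\|_{C^{0,1}(B'_{r_0})}\le Mr_0$, where $\|\varphi\|_{C^{0,1}(B'_{r_0})}=\|\varphi\|_{L^\infty(B'_{r_0})}+r_0\sup_{x\neq y\in B'_{r_0}}\frac{|\varphi(x)-\varphi(y)|}{|x-y|}$. The portion $\Gamma_I$ is of class $C^{1,1}$ with constants $r_0,M$ if for any $P\in\Gamma_I$ such a representation holds with $\varphi\in C^{1,1}(B'_{r_0})$, $|\varphi(0)|=|\nabla\varphi(0)|=0$ and $\|\varphi\|_{C^{1,1}(B'_{r_0})}\le Mr_0$, where $\|\varphi\|_{C^{1,1}(B'_{r_0})}=\|\varphi\|_{L^\infty(B'_{r_0})}+r_0\|\nabla\varphi\|_{L^\infty(B'_{r_0})}+r_0^{2}\sup_{x\ne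 y\in B'_{r_0}}\frac{|\nabla\varphi(x)-\nabla\varphi(y)|}{|x-y|}$. The a priori data are the positive constants $r_0,M,d_0,\gamma_0,E,\hat r$ (the dimension $n$ and the Hölder exponent $\alpha$, $0<\alpha\le1$, are regarded as fixed). The radius $\bar r>0$ depends on the a priori data only and is such that, for some constant $K_1>0$ depending on the a priori data only, $\int_{\Delta_{2r}(x_0)}u^2\le K_1\int_{\Delta_r(x_0)}u^2$ for every $x_0\in\Gamma_I^{r_0}$ and every $r\in(0,\bar r)$. The radius $r_1$ has the form $r_1=\min\{\tfrac{r_0}{2},r_0,\tfrac14,k_1^{1/(k_2+1)}\}$, where $k_1,k_2>0$ depend on the a priori data only and are such that, for some constant $K'>0$ depending on the a priori data only, $\int_{\Delta_r(x_0)}u^2\ge\exp(-K'r^{-K'})$ for every $x_0\in\Gamma_I^{r_0}$ and every $r\in(0,r_1)$. *)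

theory Defs
  imports "HOL-Analysis.Analysis"
begin

definition hausdorff_premeasure :: "nat \<Rightarrow> real \<Rightarrow> 'a::metric_space set \<Rightarrow> ennreal" where
  "hausdorff_premeasure d \<delta> A =
     (INF U \<in> {U :: nat \<Rightarrow> 'a set. A \<subseteq> (\<Union>i. U i) \<and> (\<forall>i. bounded (U i) \<and> diameter (U i) \<le> \<delta>)}.
        \<Sum>i. ennreal (unit_ball_vol (real d) * (diameter (U i) / 2) ^ d))"

definition hausdorff_outer :: "nat \<Rightarrow> 'a::metric_space set \<Rightarrow> ennreal" where
  "hausdorff_outer d A = (SUP \<delta> \<in> {0<..}. hausdorff_premeasure d \<delta> A)"

text \<open>The \<open>d\<close>-dimensional Hausdorff measure (\<open>d \<ge> 1\<close>), on the sigma-algebra of sets that are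
  Caratheodory measurable for the outer measure; that sigma-algebra contains the Borel sets.\<close>

definition hausdorff_measure :: "nat \<Rightarrow> 'a::metric_space measure" where
  "hausdorff_measure d =
     measure_of UNIV (lambda_system UNIV (Pow UNIV) (hausdorff_outer d)) (hausdorff_outer d)"

definition surface_measure :: "'a::euclidean_space set \<Rightarrow> 'a measure" where
  "surface_measure \<Omega> = restrict_space (hausdorff_measure (DIM('a) - 1)) (frontier \<Omega>)"

text \<open>Norms take values in \<open>[0,\<infinity>]\<close>, so a finite bound includes the membership in the
  corresponding space.  For continuous functions the \<open>L\<^sup>\<infinity>\<close> norm is the supremum.\<close>

definition sup_norm :: "'a set \<Rightarrow> ('a \<Rightarrow> 'b::real_normed_vector) \<Rightarrow> ennreal" where
  "sup_norm S f = (SUP x \<in> S. ennreal (norm (f x)))"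

definition holder_seminorm ::
    "real \<Rightarrow> 'a::metric_space set \<Rightarrow> ('a \<Rightarrow> 'b::real_normed_vector) \<Rightarrow> ennreal" where
  "holder_seminorm \<alpha> S f =
     (SUP (x, y) \<in> {(x, y). x \<in> S \<and> y \<in> S \<and> x \<noteq> y}.
        ennreal (norm (f x - f y) / dist x y powr \<alpha>))"

definition holder_norm ::
    "real \<Rightarrow> 'a::metric_space set \<Rightarrow> ('a \<Rightarrow> 'b::real_normed_vector) \<Rightarrow> ennreal" where
  "holder_norm \<alpha> S f = sup_norm S f + holder_seminorm \<alpha> S f"

text \<open>Points of \<open>\<real>\<^sup>n\<close> are written \<open>(x', x\<^sub>n)\<close>, as elements of \<open>'a \<times> real\<close> with
  \<open>DIM('a) = n - 1\<close>.  The rigid transformation is \<open>x \<mapsto> T (x - P)\<close>, which moves \<open>P\<close> to \<open>0\<close>.\<close>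

definition graph_representation ::
    "real \<Rightarrow> ('a::euclidean_space \<times> real) set \<Rightarrow> 'a \<times> real \<Rightarrow> ('a \<Rightarrow> real) \<Rightarrow> bool" where
  "graph_representation r0 \<Omega> P \<phi> \<longleftrightarrow>
     (\<exists>T. orthogonal_transformation T \<and>
        (\<lambda>x. T (x - P)) ` \<Omega> \<inter> ball 0 r0 = {(x', t). \<phi> x' < t} \<inter> ball 0 r0)"

definition lipschitz_class :: "real \<Rightarrow> real \<Rightarrow> ('a::euclidean_space \<times> real) set \<Rightarrow> bool" where
  "lipschitz_class r0 M \<Omega> \<longleftrightarrow>
     (\<forall>P \<in> frontier \<Omega>. \<exists>\<phi>. graph_representation r0 \<Omega> P \<phi> \<and>
        \<phi> 0 = 0 \<and> (GDERIV \<phi> 0 :> 0) \<and>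
        sup_norm (ball 0 r0) \<phi> + ennreal r0 * holder_seminorm 1 (ball 0 r0) \<phi>
          \<le> ennreal (M * r0))"

definition C11_portion ::
    "real \<Rightarrow> real \<Rightarrow> ('a::euclidean_space \<times> real) set \<Rightarrow> ('a \<times> real) set \<Rightarrow> bool" where
  "C11_portion r0 M \<Omega> \<Gamma> \<longleftrightarrow>
     (\<forall>P \<in> \<Gamma>. \<exists>\<phi> D\<phi>. graph_representation r0 \<Omega> P \<phi> \<and>
        (\<forall>x \<in> ball 0 r0. GDERIV \<phi> x :> D\<phi> x) \<and> \<phi> 0 = 0 \<and> D\<phi> 0 = 0 \<and>
        sup_norm (ball 0 r0) \<phi> + ennreal r0 * sup_norm (ball 0 r0) D\<phi>
          + ennreal (r0\<^sup>2) * holder_seminorm 1 (ball 0 r0) D\<phi> \<le> ennreal (M * r0))"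

definition domain_class ::
    "real \<Rightarrow> real \<Rightarrow> real \<Rightarrow> ('a::euclidean_space \<times> real) set \<Rightarrow> bool" where
  "domain_class r0 M d0 \<Omega> \<longleftrightarrow>
     open \<Omega> \<and> connected \<Omega> \<and> \<Omega> \<noteq> {} \<and> lipschitz_class r0 M \<Omega> \<and> bounded \<Omega> \<and> diameter \<Omega> \<le> d0"

definition boundary_portions :: "'a::euclidean_space set \<Rightarrow> 'a set \<Rightarrow> 'a set \<Rightarrow> bool" where
  "boundary_portions \<Omega> \<Gamma>A \<Gamma>I \<longleftrightarrow>
     openin (top_of_set (frontier \<Omega>)) \<Gamma>A \<and> openin (top_of_set (frontier \<Omega>)) \<Gamma>I \<and>
     \<Gamma>A \<inter> \<Gamma>I = {} \<and> frontier \<Omega> = closure \<Gamma>A \<union> closure \<Gamma>I"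

text \<open>\<open>inner_portion \<rho> \<Gamma>\<^sub>A \<Gamma>\<^sub>I\<close> is \<open>\<Gamma>\<^sub>A\<^sup>\<rho>\<close> and \<open>inner_portion \<rho> \<Gamma>\<^sub>I \<Gamma>\<^sub>A\<close> is \<open>\<Gamma>\<^sub>I\<^sup>\<rho>\<close>.  The distance to the
  empty set is taken to be infinite, whereas \<^const>\<open>infdist\<close> would return \<open>0\<close>.\<close>

definition inner_portion :: "real \<Rightarrow> 'a::metric_space set \<Rightarrow> 'a set \<Rightarrow> 'a set" where
  "inner_portion \<rho> \<Gamma> \<Gamma>' = {x \<in> \<Gamma>. \<Gamma>' = {} \<or> \<rho> < infdist x \<Gamma>'}"

definition surface_ball :: "'a::metric_space set \<Rightarrow> 'a \<Rightarrow> real \<Rightarrow> 'a set" where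
  "surface_ball \<Omega> x0 \<rho> = ball x0 \<rho> \<inter> frontier \<Omega>"

definition supp_on :: "'a::topological_space set \<Rightarrow> ('a \<Rightarrow> real) \<Rightarrow> 'a set" where
  "supp_on \<Gamma> f = closure {x \<in> \<Gamma>. f x \<noteq> 0}"

definition gradient :: "('a::euclidean_space \<Rightarrow> real) \<Rightarrow> 'a \<Rightarrow> 'a" where
  "gradient f x = (\<Sum>b\<in>Basis. frechet_derivative f (at x) b *\<^sub>R b)"

primrec times_diff :: "nat \<Rightarrow> ('a::euclidean_space \<Rightarrow> real) \<Rightarrow> bool" where
  "times_diff 0 f \<longleftrightarrow> continuous_on UNIV f"
| "times_diff (Suc k) f \<longleftrightarrow>
     (\<forall>x. f differentiable (at x)) \<and> (\<forall>b\<in>Basis. times_diff k (\<lambda>x. gradient f x \<bullet> b))"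

definition smooth :: "('a::euclidean_space \<Rightarrow> real) \<Rightarrow> bool" where
  "smooth f \<longleftrightarrow> (\<forall>k. times_diff k f)"

definition test_function :: "'a::euclidean_space set \<Rightarrow> ('a \<Rightarrow> real) \<Rightarrow> bool" where
  "test_function \<Omega> \<psi> \<longleftrightarrow>
     smooth \<psi> \<and> compact (closure {x. \<psi> x \<noteq> 0}) \<and> closure {x. \<psi> x \<noteq> 0} \<subseteq> \<Omega>"

definition in_L2 :: "'a measure \<Rightarrow> ('a \<Rightarrow> 'b::euclidean_space) \<Rightarrow> bool" where
  "in_L2 N f \<longleftrightarrow> f \<in> borel_measurable N \<and> integrable N (\<lambda>x. (norm (f x))\<^sup>2)"

definition tendsto_L2 ::
    "'a measure \<Rightarrow> (nat \<Rightarrow> 'a \<Rightarrow> 'b::euclidean_space) \<Rightarrow> ('a \<Rightarrow> 'b) \<Rightarrow> bool" where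
  "tendsto_L2 N F f \<longleftrightarrow> (\<lambda>k. \<integral>\<^sup>+ x. ennreal ((norm (F k x - f x))\<^sup>2) \<partial>N) \<longlonglongrightarrow> 0"

definition weak_gradient ::
    "'a::euclidean_space set \<Rightarrow> ('a \<Rightarrow> real) \<Rightarrow> ('a \<Rightarrow> 'a) \<Rightarrow> bool" where
  "weak_gradient \<Omega> u Du \<longleftrightarrow>
     (\<forall>\<psi>. test_function \<Omega> \<psi> \<longrightarrow> (\<forall>b\<in>Basis.
        (\<integral>x. u x * (gradient \<psi> x \<bullet> b) \<partial>lebesgue_on \<Omega>)
          = - (\<integral>x. (Du x \<bullet> b) * \<psi> x \<partial>lebesgue_on \<Omega>)))"

text \<open>\<open>in_H1 \<Omega> u Du\<close>: \<open>u \<in> H\<^sup>1(\<Omega>)\<close> and \<open>Du\<close> represents its weak gradient.\<close>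

definition in_H1 :: "'a::euclidean_space set \<Rightarrow> ('a \<Rightarrow> real) \<Rightarrow> ('a \<Rightarrow> 'a) \<Rightarrow> bool" where
  "in_H1 \<Omega> u Du \<longleftrightarrow>
     in_L2 (lebesgue_on \<Omega>) u \<and> in_L2 (lebesgue_on \<Omega>) Du \<and> weak_gradient \<Omega> u Du"

text \<open>The trace \<open>w\<close> of \<open>u\<close> (determined up to null sets of \<open>\<partial>\<Omega>\<close>): on a bounded Lipschitz domain the
  restrictions of smooth functions are dense in \<open>H\<^sup>1(\<Omega>)\<close>, and the trace operator is the
  continuous extension of the restriction to \<open>\<partial>\<Omega>\<close>.\<close>

definition has_trace ::
    "'a::euclidean_space set \<Rightarrow> ('a \<Rightarrow> real) \<Rightarrow> ('a \<Rightarrow> 'a) \<Rightarrow> ('a \<Rightarrow> real) \<Rightarrow> bool" where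
  "has_trace \<Omega> u Du w \<longleftrightarrow>
     in_L2 (surface_measure \<Omega>) w \<and>
     (\<exists>\<psi>. (\<forall>k. smooth (\<psi> k)) \<and>
        tendsto_L2 (lebesgue_on \<Omega>) \<psi> u \<and>
        tendsto_L2 (lebesgue_on \<Omega>) (\<lambda>k. gradient (\<psi> k)) Du \<and>
        tendsto_L2 (surface_measure \<Omega>) \<psi> w)"

text \<open>Weak form, tested with all \<open>v \<in> H\<^sup>1(\<Omega>)\<close>, of \<open>\<Delta>u = 0\<close> in \<open>\<Omega>\<close>, \<open>\<partial>u/\<partial>\<nu> = g\<close> on \<open>\<Gamma>\<^sub>A\<close> and
  \<open>\<partial>u/\<partial>\<nu> + \<gamma>u = 0\<close> on \<open>\<Gamma>\<^sub>I\<close>; here \<open>w\<close> is the trace of \<open>u\<close>.\<close>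

definition weak_solution ::
    "'a::euclidean_space set \<Rightarrow> 'a set \<Rightarrow> 'a set \<Rightarrow> ('a \<Rightarrow> real) \<Rightarrow> ('a \<Rightarrow> real)
      \<Rightarrow> ('a \<Rightarrow> real) \<Rightarrow> ('a \<Rightarrow> real) \<Rightarrow> bool" where
  "weak_solution \<Omega> \<Gamma>A \<Gamma>I g \<gamma> u w \<longleftrightarrow>
     (\<exists>Du. in_H1 \<Omega> u Du \<and> has_trace \<Omega> u Du w \<and>
        (\<forall>v Dv tv. in_H1 \<Omega> v Dv \<and> has_trace \<Omega> v Dv tv \<longrightarrow>
           (\<integral>x. Du x \<bullet> Dv x \<partial>lebesgue_on \<Omega>)
             = (LINT x:\<Gamma>A|surface_measure \<Omega>. g x * tv x)
               - (LINT x:\<Gamma>I|surface_measure \<Omega>. \<gamma> x * w x * tv x)))"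

definition admissible ::
    "real \<Rightarrow> real \<Rightarrow> real \<Rightarrow> real \<Rightarrow> real \<Rightarrow> real \<Rightarrow> real
      \<Rightarrow> ('a::euclidean_space \<times> real) set \<Rightarrow> ('a \<times> real) set \<Rightarrow> ('a \<times> real) set
      \<Rightarrow> ('a \<times> real \<Rightarrow> real) \<Rightarrow> ('a \<times> real \<Rightarrow> real)
      \<Rightarrow> ('a \<times> real \<Rightarrow> real) \<Rightarrow> ('a \<times> real \<Rightarrow> real) \<Rightarrow> bool" where
  "admissible \<alpha> r0 M d0 \<gamma>0 E rhat \<Omega> \<Gamma>A \<Gamma>I g \<gamma> u w \<longleftrightarrow>
     domain_class r0 M d0 \<Omega> \<and> boundary_portions \<Omega> \<Gamma>A \<Gamma>I \<and> C11_portion r0 M \<Omega> \<Gamma>I \<and>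
     supp_on \<Gamma>A g \<subseteq> inner_portion rhat \<Gamma>A \<Gamma>I \<and> holder_norm \<alpha> \<Gamma>A g \<le> ennreal E \<and>
     (\<forall>x\<in>\<Gamma>I. 0 \<le> \<gamma> x) \<and> supp_on \<Gamma>I \<gamma> \<subseteq> \<Gamma>I \<and> holder_norm 1 \<Gamma>I \<gamma> \<le> ennreal \<gamma>0 \<and>
     weak_solution \<Omega> \<Gamma>A \<Gamma>I g \<gamma> u w"

definition surface_mass :: "'a::euclidean_space set \<Rightarrow> ('a \<Rightarrow> real) \<Rightarrow> 'a \<Rightarrow> real \<Rightarrow> real" where
  "surface_mass \<Omega> w x0 r = (LINT x:surface_ball \<Omega> x0 r|surface_measure \<Omega>. (w x)\<^sup>2)"

end

theory Submission
  imports Defs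
begin

text \<open>The doubling inequality, iterated from scale \<open>r\<close> up to the fixed scale \<open>r\<^sub>2\<close>, loses a factor that
  is a power of \<open>r\<close>; at that fixed scale the exponential bound is merely a positive constant.\<close>

lemma doubling_imp_power_lower_bound:
  fixes F :: "real \<Rightarrow> real" and R L c r :: real
  assumes R: "R \<le> 1" and L: "1 \<le> L" and c: "0 \<le> c"
    and doubling: "\<And>r. 0 < r \<Longrightarrow> 2 * r < R \<Longrightarrow> F (2 * r) \<le> L * F r"
    and large: "\<And>r. R / 2 \<le> r \<Longrightarrow> r < R \<Longrightarrow> c \<le> F r"
    and r: "0 < r" "r < R"
  shows "c * r powr log 2 L \<le> F r"
proof -
  \<comment> \<open>The induction runs on a number \<open>n\<close> of doublings that carries
    \<open>r\<close> beyond \<open>R\<close>, with \<open>r\<close> arbitrary. The case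
    \<open>n = 0\<close> is vacuous, since it would give \<open>R < r\<close>.\<close>
  obtain n :: nat where "R / r < 2 ^ n"
    using real_arch_pow[of 2 "R / r"] by auto
  then have "R < 2 ^ n * r"
    using r by (simp add: field_simps)
  with r show ?thesis
  proof (induction n arbitrary: r)
    case 0
    then show ?case by simp
  next
    case (Suc n)
    show ?case
    proof (cases "2 * r < R")
      case True
      have "c * (2 * r) powr log 2 L \<le> F (2 * r)"
        using Suc True by (simp add: mult.assoc mult.left_commute)
      also have "\<dots> \<le> L * F r"
        using doubling Suc.prems True by simp
      \<comment> \<open>The exponent \<open>log 2 L\<close> is chosen so that doubling the radius
        multiplies the power by exactly \<open>L\<close>, the factor lost in one doubling
        step.\<close>
      finally have "L * (c * r powr log 2 L) \<le> L * F r"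
        using L Suc.prems by (simp add: powr_mult mult.left_commute)
      then show ?thesis
        using L by simp
    next
      case False
      \<comment> \<open>Here \<open>r\<close> lies in \<open>[R / 2, R)\<close>, where
        \<open>large\<close> applies. The base is at most 1 and \<open>1 \<le> L\<close> makes the
        exponent nonnegative.\<close>
      have "r powr log 2 L \<le> 1"
        using L R Suc.prems by (intro powr_le1) auto
      then have "c * r powr log 2 L \<le> c"
        using c by (simp add: mult_left_le)
      also have "\<dots> \<le> F r"
        using large False Suc.prems by simp
      finally show ?thesis .
    qed
  qed
qed

theorem theorem4p8:
  fixes \<alpha> r0 M d0 \<gamma>0 E rhat rbar K1 k1 k2 K' r1 r2 :: real
  assumes "0 < \<alpha>" and "\<alpha> \<le> 1"
    and "0 < r0" and "0 < M" and "0 < d0" and "0 < \<gamma>0" and "0 < E" and "0 < rhat"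
    and "0 < rbar" and "0 < K1" and "0 < k1" and "0 < k2" and "0 < K'"
    and "r1 = Min {r0 / 2, r0, 1 / 4, k1 powr (1 / (k2 + 1))}"
    and "r2 = min rbar r1"
  shows "\<exists>K>0. \<forall>(\<Omega> :: ((real ^ 'm) \<times> real) set) \<Gamma>A \<Gamma>I g \<gamma> u w.
    admissible \<alpha> r0 M d0 \<gamma>0 E rhat \<Omega> \<Gamma>A \<Gamma>I g \<gamma> u w \<longrightarrow>
    (\<forall>x0 \<in> inner_portion r0 \<Gamma>I \<Gamma>A. \<forall>r. 0 < r \<and> r < rbar \<longrightarrow>
       surface_mass \<Omega> w x0 (2 * r) \<le> K1 * surface_mass \<Omega> w x0 r) \<longrightarrow>
    (\<forall>x0 \<in> inner_portion r0 \<Gamma>I \<Gamma>A. \<forall>r. 0 < r \<and> r < r1 \<longrightarrow>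
       surface_mass \<Omega> w x0 r \<ge> exp (- K' * r powr (- K'))) \<longrightarrow>
    (\<forall>r x0. 0 < r \<and> r < r2 \<and> x0 \<in> inner_portion r0 \<Gamma>I \<Gamma>A \<longrightarrow>
       surface_mass \<Omega> w x0 r \<ge> (1 / K) * r powr K)"
proof -
  \<comment> \<open>Taking the maximum with 1 keeps \<open>log 2 L\<close> nonnegative.
    \<open>c\<close> is the exponential bound at \<open>r2 / 2\<close>, the left end of the last
    dyadic range. \<open>K\<close> must serve both as factor and as exponent. All three are fixed
    before the domain and the solution.\<close>
  define L c K where "L = max 1 K1" and "c = exp (- K' * (r2 / 2) powr (- K'))"
    and "K = max (1 / c) (log 2 L)"
  have r2: "0 < r2" "r2 \<le> rbar" "r2 \<le> r1" "r2 \<le> 1"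
  proof -
    have "0 < r1"
      unfolding \<open>r1 = _\<close> using \<open>0 < r0\<close> \<open>0 < k1\<close> by simp
    then show "0 < r2" "r2 \<le> rbar" "r2 \<le> r1"
      unfolding \<open>r2 = _\<close> using \<open>0 < rbar\<close> by (simp_all only: min_less_iff_conj min.cobounded1 min.cobounded2)
    have "r1 \<le> 1 / 4"
      unfolding \<open>r1 = _\<close> by (intro Min_le) auto
    then show "r2 \<le> 1"
      using \<open>r2 \<le> r1\<close> by simp
  qed
  have "0 < c" by (simp add: c_def)
  then have "0 < K"
    by (simp add: K_def less_max_iff_disj)
  \<comment> \<open>An arbitrary \<open>F\<close> stands for the mass as a function of the radius,
    so one \<open>K\<close> works for all solutions and centres.\<close>
  have bound: "(1 / K) * r powr K \<le> F r"
    if doubling: "\<And>r. 0 < r \<Longrightarrow> r < rbar \<Longrightarrow> F (2 * r) \<le> K1 * F r"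
      and lower: "\<And>r. 0 < r \<Longrightarrow> r < r1 \<Longrightarrow> exp (- K' * r powr (- K')) \<le> F r"
      and r: "0 < r" "r < r2"
    for F :: "real \<Rightarrow> real" and r
  proof -
    have "(1 / K) * r powr K \<le> c * r powr log 2 L"
    proof (rule mult_mono)
      have "1 / c \<le> K" by (simp add: K_def)
      then show "1 / K \<le> c"
        using \<open>0 < c\<close> \<open>0 < K\<close> by (simp add: field_simps)
      \<comment> \<open>For a base below 1, raising the exponent lowers the power.\<close>
      show "r powr K \<le> r powr log 2 L"
        using r r2 by (intro powr_mono') (auto simp: K_def)
    qed (use \<open>0 < c\<close> in auto)
    also have "\<dots> \<le> F r"
    proof (rule doubling_imp_power_lower_bound[where R = r2])
      fix s assume s: "0 < s" "2 * s < r2"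
      \<comment> \<open>The sign of \<open>F s\<close> is what allows \<open>K1\<close> to be
        replaced by the larger \<open>L\<close>.\<close>
      have "0 < F s"
        by (rule less_le_trans[OF _ lower]) (use s r2 in auto)
      then have "K1 * F s \<le> L * F s"
        by (simp add: L_def)
      then show "F (2 * s) \<le> L * F s"
        using doubling[of s] s r2 by simp
    next
      fix s assume s: "r2 / 2 \<le> s" "s < r2"
      \<comment> \<open>The negative exponent makes the power decreasing in \<open>s\<close>, so the
        exponential bound is weakest at \<open>r2 / 2\<close>.\<close>
      have "s powr (- K') \<le> (r2 / 2) powr (- K')"
        using s r2 \<open>0 < K'\<close> by (intro powr_mono2') auto
      then have "c \<le> exp (- K' * s powr (- K'))"
        using \<open>0 < K'\<close> by (simp add: c_def)
      also have "\<dots> \<le> F s"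
        using lower s r2 by simp
      finally show "c \<le> F s" .
    qed (use r r2 \<open>0 < c\<close> in \<open>auto simp: L_def\<close>)
    finally show ?thesis .
  qed
  show ?thesis
    using \<open>0 < K\<close> by (intro exI[of _ K] conjI allI impI) (blast intro: bound)+
qed

end
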